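(* Let $\varepsilon>0$ and $\kappa>0$, and let $(u^*,v^* )$ be an optimal solution of the approximate dual of Sinkhorn divergence $$\min\Big\{\mathbf 1_n^\top B(u,v)\mathbf 1_m-\kappa\langle u,\mu\rangle-\kappa^{-1}\langle v,\nu\rangle \;:\; u\in\mathbb R^n,\ v\in\mathbb R^m,\ e^{u_i}\ge \varepsilon\kappa^{-1}\ \forall i,\ e^{v_j}\ge\varepsilon\kappa\ \forall j\Big\}.$$ Define $$I_{\varepsilon,\kappa}=\Big\{i\in\{1,\dots,n\}:\ \mu_i\ge \frac{\varepsilon^2}{\kappa}\,r_i(K)\Big\},\qquad J_{\varepsilon,\kappa}=\Big\{j\in\{1,\dots,m\}:\ \nu_j\ge \kappa\varepsilon^2\,c_j(K)\Big\}.$$ Then $e^{u^*_i}=\varepsilon\kappa^{-1}$ for all $i\in I_{\varepsilon,\kappa}^\complement=\{1,\dots,n\}\setminus I_{\varepsilon,\kappa}$, and $e^{v^*_j}=\varepsilon\kappa$ for all $j\in J_{\varepsilon,\kappa}^\complement=\{1,\dots,m\}\setminus J_{\varepsilon,\kappa}$.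
   Context: $\mu\in\mathbb R_+^n$ and $\nu\in\mathbb R_+^m$ are probability vectors (nonnegative entries summing to $1$). $C=(C_{ij})\in\mathbb R^{n\times m}$ is a cost matrix with nonnegative entries, $\eta>0$ is a regularization parameter, and $K=e^{-C/\eta}$ (entrywise exponential), i.e. $K_{ij}=e^{-C_{ij}/\eta}$. For $u\in\mathbb R^n$, $v\in\mathbb R^m$, $B(u,v)=\mathrm{diag}(e^{u})\,K\,\mathrm{diag}(e^{v})$, i.e. $B(u,v)_{ij}=e^{u_i}K_{ij}e^{v_j}$. $r_i(K)=\sum_{j=1}^m K_{ij}$ is the $i$-th row sum and $c_j(K)=\sum_{i=1}^n K_{ij}$ the $j$-th column sum of $K$. $\mathbf 1_n$ is the all-ones vector in $\mathbb R^n$. *)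

theory Defs
  imports "HOL-Analysis.Analysis"
begin

definition prob_vec :: "real ^ 'n \<Rightarrow> bool" where
  "prob_vec p \<longleftrightarrow> (\<forall>i. 0 \<le> p $ i) \<and> (\<Sum>i\<in>UNIV. p $ i) = 1"

definition gibbs_kernel :: "real ^ 'm ^ 'n \<Rightarrow> real \<Rightarrow> real ^ 'm ^ 'n" where
  "gibbs_kernel C \<eta> = (\<chi> i j. exp (- C $ i $ j / \<eta>))"

definition diag_exp :: "real ^ 'n \<Rightarrow> real ^ 'n ^ 'n" where
  "diag_exp w = (\<chi> i j. if i = j then exp (w $ i) else 0)"

definition scaled_kernel ::
    "real ^ 'm ^ 'n \<Rightarrow> real ^ 'n \<Rightarrow> real ^ 'm \<Rightarrow> real ^ 'm ^ 'n" where
  "scaled_kernel K u v = diag_exp u ** K ** diag_exp v"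

lemma scaled_kernel_nth: "scaled_kernel K u v $ i $ j = exp (u $ i) * K $ i $ j * exp (v $ j)"
  by (simp add: scaled_kernel_def diag_exp_def matrix_matrix_mult_def if_distrib if_distribR
      cong: if_cong)

definition row_sum :: "real ^ 'm ^ 'n \<Rightarrow> 'n \<Rightarrow> real" where
  "row_sum K i = (\<Sum>j\<in>UNIV. K $ i $ j)"

definition col_sum :: "real ^ 'm ^ 'n \<Rightarrow> 'm \<Rightarrow> real" where
  "col_sum K j = (\<Sum>i\<in>UNIV. K $ i $ j)"

(* Here 1 is the all-ones vector, the unit of the componentwise multiplication on vectors. *)
definition dual_objective ::
    "real ^ 'm ^ 'n \<Rightarrow> real ^ 'n \<Rightarrow> real ^ 'm \<Rightarrow> real \<Rightarrow> (real ^ 'n) \<times> (real ^ 'm) \<Rightarrow> real" where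
  "dual_objective K \<mu> \<nu> \<kappa> = (\<lambda>(u, v).
     1 \<bullet> (scaled_kernel K u v *v 1) - \<kappa> * (u \<bullet> \<mu>) - inverse \<kappa> * (v \<bullet> \<nu>))"

definition dual_feasible :: "real \<Rightarrow> real \<Rightarrow> (real ^ 'n) \<times> (real ^ 'm) \<Rightarrow> bool" where
  "dual_feasible \<epsilon> \<kappa> = (\<lambda>(u, v).
     (\<forall>i. exp (u $ i) \<ge> \<epsilon> * inverse \<kappa>) \<and> (\<forall>j. exp (v $ j) \<ge> \<epsilon> * \<kappa>))"

definition I_set :: "real \<Rightarrow> real \<Rightarrow> real ^ 'm ^ 'n \<Rightarrow> real ^ 'n \<Rightarrow> 'n set" where
  "I_set \<epsilon> \<kappa> K \<mu> = {i. \<mu> $ i \<ge> \<epsilon>\<^sup>2 / \<kappa> * row_sum K i}"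

definition J_set :: "real \<Rightarrow> real \<Rightarrow> real ^ 'm ^ 'n \<Rightarrow> real ^ 'm \<Rightarrow> 'm set" where
  "J_set \<epsilon> \<kappa> K \<nu> = {j. \<nu> $ j \<ge> \<kappa> * \<epsilon>\<^sup>2 * col_sum K j}"

end

theory Submission
  imports Defs
begin

text \<open>
  With \<open>v\<close> fixed, the objective depends on \<open>u\<^sub>i\<close> through \<open>a e\<^bsup>u\<^sub>i\<^esup> - \<kappa> \<mu>\<^sub>i u\<^sub>i\<close>, where
  \<open>a = \<Sum>\<^sub>j K\<^sub>i\<^sub>j e\<^bsup>v\<^sub>j\<^esup> \<ge> \<epsilon> \<kappa> r\<^sub>i(K)\<close> by feasibility. Lowering \<open>u\<^sub>i\<close> to its bound \<open>t = ln (\<epsilon> / \<kappa>)\<close>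
  gains at least \<open>(a e\<^sup>t - \<kappa> \<mu>\<^sub>i) (u\<^sub>i - t)\<close>, by convexity of the exponential, and
  \<open>a e\<^sup>t \<ge> \<epsilon>\<^sup>2 r\<^sub>i(K) > \<kappa> \<mu>\<^sub>i\<close> if \<open>i \<notin> I\<close>; so at an optimum \<open>u\<^sub>i = t\<close>. The claim about \<open>v\<close> is
  the same statement for the transposed kernel and \<open>\<kappa>\<^sup>-\<^sup>1\<close>.
\<close>

text \<open>For fixed \<open>v\<close> this form separates over the coordinates of \<open>u\<close>:
  each \<open>u $ i\<close> occurs in one summand only.\<close>

lemma dual_objective_eq:
  "dual_objective K \<mu> \<nu> \<kappa> (u, v) =
     (\<Sum>i\<in>UNIV. exp (u $ i) * (\<Sum>j\<in>UNIV. K $ i $ j * exp (v $ j)) - \<kappa> * (u $ i * \<mu> $ i))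
     - inverse \<kappa> * (v \<bullet> \<nu>)"
  by (simp add: dual_objective_def inner_vec_def matrix_vector_mult_def scaled_kernel_nth
      sum_subtractf sum_distrib_left mult.assoc)

text \<open>Swapping the order of summation leaves the total mass of the scaled kernel unchanged,
  and inverting \<kappa> exchanges the weights of the two linear terms.\<close>

lemma dual_objective_transpose:
  "dual_objective (transpose K) \<nu> \<mu> (inverse \<kappa>) (v, u) = dual_objective K \<mu> \<nu> \<kappa> (u, v)"
proof -
  have "(\<Sum>i\<in>UNIV. \<Sum>j\<in>UNIV. exp (v $ i) * (K $ j $ i * exp (u $ j))) =
        (\<Sum>i\<in>UNIV. \<Sum>j\<in>UNIV. exp (u $ i) * (K $ i $ j * exp (v $ j)))"
    by (subst sum.swap) (simp add: mult_ac)
  then show ?thesis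
    by (simp add: dual_objective_def inner_vec_def matrix_vector_mult_def scaled_kernel_nth
        transpose_def mult.assoc)
qed

lemma dual_feasible_swap:
  "dual_feasible \<epsilon> (inverse \<kappa>) (v, u) \<longleftrightarrow> dual_feasible \<epsilon> \<kappa> (u, v)"
  by (auto simp: dual_feasible_def)

lemma is_arg_min_transpose:
  assumes "is_arg_min (dual_objective K \<mu> \<nu> \<kappa>) (dual_feasible \<epsilon> \<kappa>) (u, v)"
  shows "is_arg_min (dual_objective (transpose K) \<nu> \<mu> (inverse \<kappa>))
           (dual_feasible \<epsilon> (inverse \<kappa>)) (v, u)"
  using assms by (auto simp: is_arg_min_def dual_objective_transpose dual_feasible_swap)

text \<open>The graph of \<open>exp\<close> lies above its tangent at \<open>t\<close>: scale
  \<open>1 + y \<le> exp y\<close> at \<open>y = x - t\<close> by \<open>exp t\<close>.\<close>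

lemma exp_diff_ge: "exp t * (x - t) \<le> exp x - exp t" for x t :: real
proof -
  have "exp t * (1 + (x - t)) \<le> exp t * exp (x - t)"
    by (intro mult_left_mono exp_ge_add_one_self) simp
  then show ?thesis
    by (simp add: algebra_simps flip: exp_add)
qed

text \<open>Asking only for nonnegative entries lets this serve both \<open>K\<close> and its
  transpose.\<close>

lemma arg_min_at_lower_bound:
  fixes \<mu> :: "real ^ 'n" and \<nu> :: "real ^ 'm" and K :: "real ^ 'm ^ 'n"
  assumes nonneg: "\<And>i j. 0 \<le> K $ i $ j"
    and pos: "0 < \<epsilon>" "0 < \<kappa>"
    and opt: "is_arg_min (dual_objective K \<mu> \<nu> \<kappa>) (dual_feasible \<epsilon> \<kappa>) (u, v)"
    and small: "\<mu> $ i < \<epsilon>\<^sup>2 / \<kappa> * row_sum K i"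
  shows "exp (u $ i) = \<epsilon> * inverse \<kappa>"
proof (rule ccontr)
  assume neq: "exp (u $ i) \<noteq> \<epsilon> * inverse \<kappa>"
  define t where "t = ln (\<epsilon> * inverse \<kappa>)"
  have exp_t: "exp t = \<epsilon> * inverse \<kappa>"
    using pos by (simp add: t_def)
  have feas: "dual_feasible \<epsilon> \<kappa> (u, v)"
    using opt by (simp add: is_arg_min_def)
  then have "exp t < exp (u $ i)"
    using neq unfolding exp_t dual_feasible_def by (simp add: order_less_le)
  then have less: "t < u $ i"
    by simp
  define a where "a k = (\<Sum>j\<in>UNIV. K $ k $ j * exp (v $ j))" for k
  \<comment> \<open>The competitor lowers coordinate \<open>i\<close> to its bound and keeps the
    others, so only summand \<open>i\<close> changes.\<close>
  define u' where "u' = (\<chi> k. if k = i then t else u $ k)"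
  define h where "h w k = exp (w $ k) * a k - \<kappa> * (w $ k * \<mu> $ k)" for w :: "real ^ 'n" and k
  have "dual_feasible \<epsilon> \<kappa> (u', v)"
    using feas exp_t by (simp add: dual_feasible_def u'_def)
  then have "dual_objective K \<mu> \<nu> \<kappa> (u, v) \<le> dual_objective K \<mu> \<nu> \<kappa> (u', v)"
    using opt by (auto simp: is_arg_min_def not_less)
  then have "sum (h u) UNIV \<le> sum (h u') UNIV"
    by (simp add: dual_objective_eq h_def a_def)
  moreover have "sum (h u) (UNIV - {i}) = sum (h u') (UNIV - {i})"
    by (rule sum.cong) (auto simp: h_def u'_def)
  ultimately have "h u i \<le> h u' i"
    by (simp add: sum.remove[of UNIV i])
  then have le: "a i * (exp (u $ i) - exp t) \<le> \<kappa> * \<mu> $ i * (u $ i - t)"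
    by (simp add: h_def u'_def algebra_simps)
  have "row_sum K i * (\<epsilon> * \<kappa>) \<le> a i"
    unfolding row_sum_def a_def sum_distrib_right
    using feas nonneg by (intro sum_mono mult_left_mono) (auto simp: dual_feasible_def)
  then have "row_sum K i * (\<epsilon> * \<kappa>) * exp t \<le> a i * exp t"
    by (rule mult_right_mono) simp
  then have "\<epsilon>\<^sup>2 * row_sum K i \<le> a i * exp t"
    using pos by (simp add: exp_t power2_eq_square field_simps)
  moreover have "\<kappa> * \<mu> $ i < \<epsilon>\<^sup>2 * row_sum K i"
    using small pos by (simp add: field_simps)
  ultimately have "\<kappa> * \<mu> $ i * (u $ i - t) < a i * exp t * (u $ i - t)"
    using less by (intro mult_strict_right_mono) auto
  also have "\<dots> \<le> a i * (exp (u $ i) - exp t)"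
    using exp_diff_ge[of t "u $ i"] nonneg
    by (simp add: mult.assoc mult_left_mono a_def sum_nonneg)
  finally show False
    using le by simp
qed

theorem lemma1:
  fixes \<mu> :: "real ^ 'n" and \<nu> :: "real ^ 'm"
    and C K :: "real ^ 'm ^ 'n"
    and \<eta> \<epsilon> \<kappa> :: real
    and u_opt :: "real ^ 'n" and v_opt :: "real ^ 'm"
  assumes "prob_vec \<mu>" and "prob_vec \<nu>"
    and "\<And>i j. 0 \<le> C $ i $ j"
    and "0 < \<eta>"
    and "K = gibbs_kernel C \<eta>"
    and "0 < \<epsilon>" and "0 < \<kappa>"
    and "is_arg_min (dual_objective K \<mu> \<nu> \<kappa>) (dual_feasible \<epsilon> \<kappa>) (u_opt, v_opt)"
  shows "(\<forall>i \<in> - I_set \<epsilon> \<kappa> K \<mu>. exp (u_opt $ i) = \<epsilon> * inverse \<kappa>) \<and>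
         (\<forall>j \<in> - J_set \<epsilon> \<kappa> K \<nu>. exp (v_opt $ j) = \<epsilon> * \<kappa>)"
proof (intro conjI ballI)
  have nonneg: "0 \<le> K $ i $ j" for i j
    using assms(5) by (simp add: gibbs_kernel_def)
  show "exp (u_opt $ i) = \<epsilon> * inverse \<kappa>" if "i \<in> - I_set \<epsilon> \<kappa> K \<mu>" for i
    using arg_min_at_lower_bound[OF nonneg assms(6-8)] that by (simp add: I_set_def)
  show "exp (v_opt $ j) = \<epsilon> * \<kappa>" if "j \<in> - J_set \<epsilon> \<kappa> K \<nu>" for j
  proof -
    \<comment> \<open>Columns of \<open>K\<close> are rows of its transpose, and dividing by
      \<open>inverse \<kappa>\<close> restores the factor \<kappa> in the threshold of
      \<open>J_set\<close>.\<close>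
    have "\<nu> $ j < \<epsilon>\<^sup>2 / inverse \<kappa> * row_sum (transpose K) j"
      using that by (simp add: J_set_def row_sum_def col_sum_def transpose_def field_simps)
    then have "exp (v_opt $ j) = \<epsilon> * inverse (inverse \<kappa>)"
      using nonneg assms(6,7)
      by (intro arg_min_at_lower_bound[OF _ _ _ is_arg_min_transpose[OF assms(8)]])
        (auto simp: transpose_def)
    then show ?thesis
      by simp
  qed
qed

end
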